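(* Let $D$ be an oriented graph. Then $\mathrm{inv}(\overrightarrow{C_3} \Rightarrow D)=\mathrm{inv}(D \Rightarrow \overrightarrow{C_3})$.
   Context: All digraphs are finite and have no loops, parallel arcs or 2-cycles (i.e. they are oriented graphs). $\overrightarrow{C_3}$ denotes the directed cycle on three vertices. For a digraph $D$ with vertex set $V(D)$ and a subset $X\subseteq V(D)$, the inversion of $X$ in $D$ is the digraph $\mathrm{Inv}(D;X)$ obtained from $D$ by reversing the direction of all arcs with both ends in $X$. For a finite family $(X_i)_{i\in I}$ of subsets of $V(D)$, $\mathrm{Inv}(D;(X_i)_{i\in I})$ is obtained by inverting the sets $X_i$ one after another (the order does not matter). The family is a decycling family if $\mathrm{Inv}(D;(X_i)_{i\in I})$ is acyclic. The inversion number $\mathrm{inv}(D)$ is the minimum cardinality $|I|$ of a decycling family of $D$. For (vertex-disjoint) oriented graphs $L,R$, the dijoin $L\Rightarrow R$ is the oriented graph obtained from the disjoint union of $L$ and $R$ by adding all arcs $uv$ with $u\in V(L)$, $v\in V(R)$. *)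

theory Defs
  imports "Graph_Theory.Pair_Digraph"
begin

text \<open>
  Digraphs are the pair digraphs of the library: the arcs form a set of vertex pairs, so there are no
  parallel arcs, and the locale \<^locale>\<open>pair_digraph\<close> adds finiteness and the absence of loops.
\<close>

locale oriented_graph = pair_digraph D for D :: "'a pair_pre_digraph" +
  assumes no_2_cycles: "(u, v) \<in> parcs D \<Longrightarrow> (v, u) \<notin> parcs D"

definition acyclic_digraph :: "'a pair_pre_digraph \<Rightarrow> bool" where
  "acyclic_digraph D \<longleftrightarrow> \<not> (\<exists>p. pre_digraph.cycle (with_proj D) p)"

definition inversion :: "'a set \<Rightarrow> 'a pair_pre_digraph \<Rightarrow> 'a pair_pre_digraph" where
  "inversion X D =
     \<lparr> pverts = pverts D,
       parcs = (\<lambda>(u, v). if u \<in> X \<and> v \<in> X then (v, u) else (u, v)) ` parcs D \<rparr>"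

text \<open>
  A finite family of vertex sets is a list (repetitions allowed); its cardinality is the length of
  the list. The sets are inverted one after another, from left to right.
\<close>

definition inversions :: "'a set list \<Rightarrow> 'a pair_pre_digraph \<Rightarrow> 'a pair_pre_digraph" where
  "inversions Xs D = fold inversion Xs D"

definition decycling_family :: "'a pair_pre_digraph \<Rightarrow> 'a set list \<Rightarrow> bool" where
  "decycling_family D Xs \<longleftrightarrow>
     (\<forall>X \<in> set Xs. X \<subseteq> pverts D) \<and> acyclic_digraph (inversions Xs D)"

definition inversion_number :: "'a pair_pre_digraph \<Rightarrow> nat" where
  "inversion_number D = (LEAST k. \<exists>Xs. length Xs = k \<and> decycling_family D Xs)"

text \<open>
  The dijoin lives on the sum of the two vertex types, so its two parts are disjoint by construction.
\<close>

definition dijoin :: "'a pair_pre_digraph \<Rightarrow> 'b pair_pre_digraph \<Rightarrow> ('a + 'b) pair_pre_digraph" where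
  "dijoin L R =
     \<lparr> pverts = pverts L <+> pverts R,
       parcs = map_prod Inl Inl ` parcs L \<union> map_prod Inr Inr ` parcs R
             \<union> {(Inl u, Inr v) | u v. u \<in> pverts L \<and> v \<in> pverts R} \<rparr>"

definition directed_C3 :: "nat pair_pre_digraph" where
  "directed_C3 = \<lparr> pverts = {0, 1, 2}, parcs = {(0, 1), (1, 2), (2, 0)} \<rparr>"

lemma oriented_graph_directed_C3: "oriented_graph directed_C3"
  by unfold_locales (auto simp: directed_C3_def)

lemma oriented_graph_dijoin:
  assumes "oriented_graph L" "oriented_graph R"
  shows "oriented_graph (dijoin L R)"
proof -
  interpret L: oriented_graph L by fact
  interpret R: oriented_graph R by fact
  have fin: "finite {(Inl u :: 'a + 'b, Inr v :: 'a + 'b) | u v. u \<in> pverts L \<and> v \<in> pverts R}"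
    by (rule finite_subset[of _ "(\<lambda>(u, v). (Inl u, Inr v)) ` (pverts L \<times> pverts R)"]) auto
  show ?thesis
    by unfold_locales
      (use fin in \<open>auto simp: dijoin_def dest: L.in_arcsD1 L.in_arcsD2 R.in_arcsD1 R.in_arcsD2
        L.no_2_cycles R.no_2_cycles L.pair_no_loops R.pair_no_loops\<close>)
qed

lemma oriented_graph_inversion:
  assumes "oriented_graph D"
  shows "oriented_graph (inversion X D)"
proof -
  interpret oriented_graph D by fact
  show ?thesis
    by unfold_locales
      (auto simp: inversion_def split: if_splits dest: in_arcsD1 in_arcsD2 no_2_cycles pair_no_loops)
qed

lemma acyclic_digraphI:
  assumes "pair_wf_digraph D" and "acyclic (parcs D)"
  shows "acyclic_digraph D"
proof -
  interpret pair_wf_digraph D by fact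
  show ?thesis
    unfolding acyclic_digraph_def
  proof
    assume "\<exists>p. pre_digraph.cycle (with_proj D) p"
    then obtain u p where "awalk u p u" "p \<noteq> []" by (auto simp: cycle_def)
    then have "(u, u) \<in> (arcs_ends (with_proj D))\<^sup>+" by (auto simp: reachable1_awalk)
    with assms(2) show False by (simp add: acyclic_def)
  qed
qed

text \<open>
  Every oriented graph has a decycling family, since single arcs can be reversed one by one; so the
  minimum in \<^const>\<open>inversion_number\<close> is over a nonempty set.
\<close>

lemma decycling_family_exists:
  fixes D :: "'a pair_pre_digraph"
  assumes "oriented_graph D"
  shows "\<exists>Xs. decycling_family D Xs"
proof -
  have "finite (pverts D)"
    using assms by (simp add: oriented_graph_def pair_digraph_def pair_fin_digraph_def
        pair_fin_digraph_axioms_def)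
  then obtain f :: "'a \<Rightarrow> nat" where f: "inj_on f (pverts D)"
    using finite_imp_inj_to_nat_seg[of "pverts D"] by auto
  show ?thesis using assms f
  proof (induction "card {(u, v) \<in> parcs D. f v < f u}" arbitrary: D rule: less_induct)
    case less
    interpret oriented_graph D by fact
    let ?B = "\<lambda>D. {(u, v) \<in> parcs D. f v < f u}"
    show ?case
    proof (cases "?B D = {}")
      case True
      have "f u < f v" if uv: "(u, v) \<in> parcs D" for u v
      proof -
        have "f u \<noteq> f v"
          using inj_onD[OF less.prems(2)] in_arcsD1[OF uv] in_arcsD2[OF uv] pair_no_loops[OF uv]
          by fastforce
        moreover have "\<not> f v < f u" using True uv by blast
        ultimately show ?thesis by linarith
      qed
      then have "parcs D \<subseteq> measure f" by auto
      then have "acyclic (parcs D)" by (meson acyclic_subset wf_acyclic wf_measure)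
      then have "decycling_family D []"
        by (simp add: decycling_family_def inversions_def acyclic_digraphI pair_wf_digraph)
      then show ?thesis ..
    next
      case False
      then obtain u v where uv: "(u, v) \<in> parcs D" "f v < f u" by auto
      let ?D = "inversion {u, v} D"
      have "?B ?D \<subset> ?B D"
      proof
        show "?B ?D \<subseteq> ?B D"
          using uv by (auto simp: inversion_def split: if_splits)
        have "(u, v) \<notin> parcs ?D"
          using no_2_cycles[OF uv(1)] by (auto simp: inversion_def split: if_splits)
        then show "?B ?D \<noteq> ?B D" using uv by auto
      qed
      moreover have "finite (?B D)" using pair_finite_arcs by (rule rev_finite_subset) auto
      ultimately have "card (?B ?D) < card (?B D)" by (simp add: psubset_card_mono)
      moreover have "inj_on f (pverts ?D)" using less.prems(2) by (simp add: inversion_def)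
      ultimately obtain Xs where "decycling_family ?D Xs"
        using less.hyps oriented_graph_inversion[OF less.prems(1)] by blast
      then have "decycling_family D ({u, v} # Xs)"
        using in_arcsD1[OF uv(1)] in_arcsD2[OF uv(1)]
        by (simp add: decycling_family_def inversions_def) (simp add: inversion_def)
      then show ?thesis ..
    qed
  qed
qed

end

theory Submission
  imports Defs "HOL-Library.Z2"
begin

text \<open>
  A family of \<open>k\<close> vertex sets is an assignment of vectors \<open>z v\<close> over the two-element field, of
  dimension \<open>k\<close>: an arc \<open>(u, v)\<close> gets reversed iff the dot product \<open>z u \<cdot> z v\<close> is \<open>1\<close>. The family is
  decycling iff some numbering \<open>f\<close> of the vertices increases along all arcs of the resulting digraph
  (\<open>decycling_family_iff\<close>).

  Take a decycling family of size \<open>k\<close> of the dijoin of \<open>D\<close> and the directed triangle, in either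
  order. Some arc of the triangle is reversed, so it has vertices with vectors \<open>p\<close>, \<open>q\<close> such that
  \<open>p \<cdot> q = 1\<close>. A triangle vertex is joined to all of \<open>D\<close> in the same direction, so the vertices \<open>v\<close>
  of \<open>D\<close> with \<open>z v \<cdot> p = 1\<close> are exactly those on one side of that vertex in the numbering: an initial
  segment if the triangle comes first, a final segment if it comes last. The same holds for \<open>q\<close>, on
  the same side, so the two segments are nested.

  This permits to project the vectors of \<open>D\<close> orthogonally without destroying acyclicity. If \<open>p \<cdot> p = 1\<close>
  or \<open>q \<cdot> q = 1\<close>, projecting along that vector reverses all arcs inside one segment
  (\<open>reverse_segment\<close>). Otherwise \<open>p\<close>, \<open>q\<close> span a hyperbolic plane, and projecting along it reverses
  the arcs between the smaller segment and the rest of the larger one, that is, it swaps two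
  consecutive segments (\<open>swap_segments\<close>). Either way \<open>D\<close> is decycled by vectors orthogonal to two
  vectors \<open>p'\<close>, \<open>q'\<close> with \<open>p' \<cdot> q' = 1\<close> (\<open>orthogonalise\<close>). Give the triangle the vectors \<open>0\<close>, \<open>p'\<close>, \<open>q'\<close>:
  it becomes transitive and no arc between it and \<open>D\<close> is reversed, so both dijoins are decycled
  with \<open>k\<close> sets. Hence the two dijoins have decycling families of the same sizes.
\<close>

section \<open>Decycling families as vector assignments\<close>

definition dot :: "nat \<Rightarrow> (nat \<Rightarrow> bit) \<Rightarrow> (nat \<Rightarrow> bit) \<Rightarrow> bit" where
  "dot k a b = (\<Sum>i<k. a i * b i)"

lemma dot_commute: "dot k a b = dot k b a"
  unfolding dot_def by (rule sum.cong[OF refl mult.commute])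

lemma dot_add_scaled_left: "dot k (\<lambda>i. a i + s * b i) c = dot k a c + s * dot k b c"
  unfolding dot_def distrib_right sum.distrib sum_distrib_left mult.assoc by (rule refl)

lemma dot_add_scaled_right: "dot k c (\<lambda>i. a i + s * b i) = dot k c a + s * dot k c b"
  by (subst (1 2 3) dot_commute) (rule dot_add_scaled_left)

lemma dot_zero: "dot k (\<lambda>i. 0) a = 0" "dot k a (\<lambda>i. 0) = 0"
  unfolding dot_def by simp_all

definition flip_arc :: "('a \<Rightarrow> 'a \<Rightarrow> bit) \<Rightarrow> 'a \<times> 'a \<Rightarrow> 'a \<times> 'a" where
  "flip_arc b = (\<lambda>(u, v). if b u v = 1 then (v, u) else (u, v))"

text \<open>
  An arc is to be reversed iff \<open>b\<close> is \<open>1\<close> on it. For finite \<open>E\<close>, such an \<open>f\<close> exists iff these reversals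
  make \<open>E\<close> acyclic.
\<close>

definition numbering :: "('a \<Rightarrow> 'a \<Rightarrow> bit) \<Rightarrow> ('a \<Rightarrow> int) \<Rightarrow> ('a \<times> 'a) set \<Rightarrow> bool" where
  "numbering b f E \<longleftrightarrow> (\<forall>(u, v) \<in> E. if b u v = 1 then f v < f u else f u < f v)"

lemma numbering_iff_flip_arc:
  "numbering b f E \<longleftrightarrow> (\<forall>(u, v) \<in> flip_arc b ` E. f u < f v)"
  unfolding numbering_def flip_arc_def ball_simps
  by (intro ball_cong refl) (simp only: split_beta if_distrib[of fst] if_distrib[of snd] fst_conv
      snd_conv split: if_split, iprover)

lemma acyclic_iff_numbering:
  assumes "finite E"
  shows "acyclic E \<longleftrightarrow> (\<exists>f :: 'a \<Rightarrow> int. \<forall>(u, v) \<in> E. f u < f v)"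
proof
  assume ac: "acyclic E"
  \<comment> \<open>Number each vertex by how many vertices reach it.\<close>
  let ?R = "\<lambda>v. {w. (w, v) \<in> E\<^sup>+}"
  have fin: "finite (?R v)" for v
    using finite_subset[of "?R v" "fst ` (E\<^sup>+)"] assms
    by (force simp: finite_trancl)
  have "card (?R u) < card (?R v)" if "(u, v) \<in> E" for u v
  proof (rule psubset_card_mono[OF fin])
    have "u \<notin> ?R u" using ac by (simp add: acyclic_def)
    moreover have "u \<in> ?R v" using that by auto
    moreover have "?R u \<subseteq> ?R v" using that by (auto intro: trancl_into_trancl)
    ultimately show "?R u \<subset> ?R v" by blast
  qed
  then show "\<exists>f :: 'a \<Rightarrow> int. \<forall>(u, v) \<in> E. f u < f v"
    by (intro exI[of _ "\<lambda>v. int (card (?R v))"]) auto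
next
  assume "\<exists>f :: 'a \<Rightarrow> int. \<forall>(u, v) \<in> E. f u < f v"
  then obtain f :: "'a \<Rightarrow> int" where f: "\<And>u v. (u, v) \<in> E \<Longrightarrow> f u < f v" by auto
  have "f u < f v" if "(u, v) \<in> E\<^sup>+" for u v
    using that by induction (use f in \<open>force+\<close>)
  then show "acyclic E" by (fastforce simp: acyclic_def)
qed

lemma acyclic_digraph_iff:
  assumes "pair_wf_digraph D"
  shows "acyclic_digraph D \<longleftrightarrow> acyclic (parcs D)"
proof
  interpret pair_wf_digraph D by fact
  assume D: "acyclic_digraph D"
  show "acyclic (parcs D)"
    unfolding acyclic_def
  proof (intro allI notI)
    fix u assume "(u, u) \<in> (parcs D)\<^sup>+"
    then have "(u, u) \<in> (arcs_ends (with_proj D))\<^sup>+" by simp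
    then obtain p where "awalk u p u" "p \<noteq> []" by (auto simp: reachable1_awalk)
    then have "closed_w p" by (auto simp: closed_w_def)
    then have "\<exists>p. cycle p" by (rule closed_w_imp_cycle)
    with D show False by (simp add: acyclic_digraph_def)
  qed
qed (use assms acyclic_digraphI in blast)

lemma oriented_graph_inversions:
  assumes "oriented_graph D"
  shows "oriented_graph (inversions Xs D)"
  using assms unfolding inversions_def
  by (induction Xs arbitrary: D) (simp_all add: oriented_graph_inversion)

text \<open>
  Inverting sets one after another reverses an arc as often as both of its ends lie in one of the
  sets, so only the parity of this number matters.
\<close>

lemma parcs_inversions:
  "parcs (inversions Xs D) = flip_arc (\<lambda>u v. \<Sum>X\<leftarrow>Xs. of_bool (u \<in> X \<and> v \<in> X)) ` parcs D"
proof (induction Xs arbitrary: D)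
  case Nil
  then show ?case by (simp add: inversions_def flip_arc_def case_prod_unfold)
next
  case (Cons X Xs)
  have comm: "(\<Sum>X\<leftarrow>Xs. of_bool (u \<in> X \<and> v \<in> X)) = (\<Sum>X\<leftarrow>Xs. (of_bool (v \<in> X \<and> u \<in> X) :: bit))"
    for u v by (simp add: conj_commute)
  have "inversions (X # Xs) D = inversions Xs (inversion X D)" by (simp add: inversions_def)
  then have "parcs (inversions (X # Xs) D)
      = flip_arc (\<lambda>u v. \<Sum>X\<leftarrow>Xs. of_bool (u \<in> X \<and> v \<in> X)) ` parcs (inversion X D)"
    by (simp add: Cons.IH)
  also have "\<dots> = flip_arc (\<lambda>u v. \<Sum>X\<leftarrow>X # Xs. of_bool (u \<in> X \<and> v \<in> X)) ` parcs D"
    unfolding inversion_def by (auto simp: image_image flip_arc_def comm intro!: image_cong)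
  finally show ?case .
qed

lemma acyclic_inversions_iff:
  assumes "oriented_graph D"
  shows "acyclic_digraph (inversions Xs D) \<longleftrightarrow>
    (\<exists>f. numbering (\<lambda>u v. \<Sum>X\<leftarrow>Xs. of_bool (u \<in> X \<and> v \<in> X)) f (parcs D))"
proof -
  interpret oriented_graph "inversions Xs D"
    by (rule oriented_graph_inversions) fact
  have "acyclic_digraph (inversions Xs D) \<longleftrightarrow>
      (\<exists>f :: _ \<Rightarrow> int. \<forall>(u, v) \<in> parcs (inversions Xs D). f u < f v)"
    by (simp add: acyclic_digraph_iff pair_wf_digraph_axioms acyclic_iff_numbering)
  then show ?thesis
    unfolding numbering_iff_flip_arc parcs_inversions .
qed

definition dot_numbering ::
  "nat \<Rightarrow> ('a \<Rightarrow> nat \<Rightarrow> bit) \<Rightarrow> ('a \<Rightarrow> int) \<Rightarrow> ('a \<times> 'a) set \<Rightarrow> bool" where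
  "dot_numbering k z = numbering (\<lambda>u v. dot k (z u) (z v))"

lemma dot_numbering_iff:
  "dot_numbering k z f E \<longleftrightarrow>
    (\<forall>u v. (u, v) \<in> E \<longrightarrow> (if dot k (z u) (z v) = 1 then f v < f u else f u < f v))"
  unfolding dot_numbering_def numbering_def Ball_def split_paired_All case_prod_conv by (rule refl)

lemma dot_numberingI:
  assumes "\<And>u v. (u, v) \<in> E \<Longrightarrow> if dot k (z u) (z v) = 1 then f v < f u else f u < f v"
  shows "dot_numbering k z f E"
  unfolding dot_numbering_iff using assms by (intro allI impI)

lemma dot_numberingD:
  assumes "dot_numbering k z f E" "(u, v) \<in> E"
  shows "if dot k (z u) (z v) = 1 then f v < f u else f u < f v"
  using assms(1)[unfolded dot_numbering_iff, rule_format, OF assms(2)] .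

lemma dot_numbering_converse:
  "dot_numbering k z f (E\<inverse>) \<longleftrightarrow> dot_numbering k z (\<lambda>v. - f v) E"
proof -
  have "(\<forall>u v. (u, v) \<in> E\<inverse> \<longrightarrow> P u v) \<longleftrightarrow> (\<forall>u v. (u, v) \<in> E \<longrightarrow> P v u)" for P by blast
  then show ?thesis
    unfolding dot_numbering_iff neg_less_iff_less by (subst dot_commute)
qed

lemma decycling_family_iff:
  assumes "oriented_graph D"
  shows "(\<exists>Xs. length Xs = k \<and> decycling_family D Xs) \<longleftrightarrow>
    (\<exists>z f. dot_numbering k z f (parcs D))"
proof
  assume "\<exists>Xs. length Xs = k \<and> decycling_family D Xs"
  then obtain Xs f where Xs: "length Xs = k"
    and f: "numbering (\<lambda>u v. \<Sum>X\<leftarrow>Xs. of_bool (u \<in> X \<and> v \<in> X)) f (parcs D)"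
    using acyclic_inversions_iff[OF assms] by (auto simp: decycling_family_def)
  define z where "z v i = (of_bool (v \<in> Xs ! i) :: bit)" for v i
  have "dot k (z u) (z v) = (\<Sum>X\<leftarrow>Xs. of_bool (u \<in> X \<and> v \<in> X))" for u v
    using Xs by (simp add: dot_def z_def sum_list_sum_nth atLeast0LessThan of_bool_conj
        del: mult_bit_eq_and)
  with f have "dot_numbering k z f (parcs D)" by (simp add: dot_numbering_def)
  then show "\<exists>z f. dot_numbering k z f (parcs D)" by blast
next
  interpret oriented_graph D by fact
  assume "\<exists>z f. dot_numbering k z f (parcs D)"
  then obtain z f where f: "dot_numbering k z f (parcs D)" by blast
  define Xs where "Xs = map (\<lambda>i. {v \<in> pverts D. z v i = 1}) [0..<k]"
  have "(\<Sum>X\<leftarrow>Xs. of_bool (u \<in> X \<and> v \<in> X)) = dot k (z u) (z v)"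
    if "u \<in> pverts D" "v \<in> pverts D" for u v
  proof -
    have "of_bool (z u i = 1 \<and> z v i = 1) = z u i * z v i" for i
      by (cases "z u i"; cases "z v i") simp_all
    then show ?thesis using that
      by (simp add: dot_def Xs_def sum_list_sum_nth atLeast0LessThan del: mult_bit_eq_and)
  qed
  with f have "numbering (\<lambda>u v. \<Sum>X\<leftarrow>Xs. of_bool (u \<in> X \<and> v \<in> X)) f (parcs D)"
    unfolding dot_numbering_def numbering_def by (fastforce dest: in_arcsD1 in_arcsD2)
  then have "decycling_family D Xs"
    using acyclic_inversions_iff[OF assms] by (auto simp: decycling_family_def Xs_def)
  then show "\<exists>Xs. length Xs = k \<and> decycling_family D Xs"
    by (intro exI[of _ Xs]) (simp add: Xs_def)
qed

section \<open>Orthogonal projection of vector assignments\<close>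

lemma finite_int_bound:
  fixes f :: "'a \<Rightarrow> int"
  assumes "finite V"
  obtains N where "\<And>v. v \<in> V \<Longrightarrow> \<bar>f v\<bar> < N"
proof
  fix v assume "v \<in> V"
  then have "\<bar>f v\<bar> \<le> Max ((\<lambda>v. \<bar>f v\<bar>) ` V)" using assms by simp
  then show "\<bar>f v\<bar> < Max ((\<lambda>v. \<bar>f v\<bar>) ` V) + 1" by simp
qed

text \<open>
  Projecting all vectors along \<open>w\<close> changes \<open>x u \<cdot> x v\<close> by \<open>(x u \<cdot> w) (x v \<cdot> w)\<close>, which is \<open>1\<close> iff \<open>u\<close>
  and \<open>v\<close> both lie in the initial segment cut out by \<open>w\<close>. Reversing the order of that segment makes
  up for this.
\<close>

lemma reverse_segment:
  assumes "finite V" "E \<subseteq> V \<times> V" and f: "dot_numbering k x f E"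
    and w: "dot k w w = 1" "\<And>v. v \<in> V \<Longrightarrow> dot k (x v) w = 1 \<longleftrightarrow> f v < c"
  shows "\<exists>y g. dot_numbering k y g E \<and> (\<forall>v. dot k (y v) w = 0)"
proof -
  obtain N where N: "\<And>v. v \<in> V \<Longrightarrow> \<bar>f v\<bar> < N" using finite_int_bound[OF assms(1)] by blast
  define y where "y v = (\<lambda>i. x v i + dot k (x v) w * w i)" for v
  \<comment> \<open>As all numbers lie strictly between \<open>- N\<close> and \<open>N\<close>, the shift puts the rest after the reversed
    segment.\<close>
  define g where "g v = (if f v < c then - f v else f v + 2 * N)" for v
  have dot_w: "dot k (y v) w = 0" for v
    unfolding y_def dot_add_scaled_left w(1) by (cases "dot k (x v) w") simp_all
  have dot_y: "dot k (y u) (y v) = dot k (x u) (x v) + dot k (x u) w * dot k (x v) w" for u v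
    unfolding y_def dot_add_scaled_left dot_add_scaled_right w(1) dot_commute[of k w "x v"]
    by (cases "dot k (x u) w"; cases "dot k (x v) w") simp_all
  have "if dot k (y u) (y v) = 1 then g v < g u else g u < g v" if "(u, v) \<in> E" for u v
  proof -
    have uv: "u \<in> V" "v \<in> V" using that assms(2) by auto
    show ?thesis
      using dot_numberingD[OF f that] w(2)[OF uv(1)] w(2)[OF uv(2)] N[OF uv(1)] N[OF uv(2)]
      unfolding dot_y g_def
      by (cases "dot k (x u) (x v)"; cases "dot k (x u) w"; cases "dot k (x v) w")
        (simp_all split: if_splits)
  qed
  then have "dot_numbering k y g E" by (rule dot_numberingI)
  then show ?thesis using dot_w by blast
qed

text \<open>
  Here \<open>p\<close>, \<open>q\<close> are isotropic with \<open>p \<cdot> q = 1\<close>, and projecting onto the orthogonal complement of their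
  plane changes \<open>x u \<cdot> x v\<close> by \<open>(x u \<cdot> p) (x v \<cdot> q) + (x u \<cdot> q) (x v \<cdot> p)\<close>. Since the segment of \<open>p\<close> is
  contained in that of \<open>q\<close>, this is \<open>1\<close> iff one of \<open>u\<close>, \<open>v\<close> is in the segment of \<open>p\<close> and the other one
  is in that of \<open>q\<close> only: these two consecutive blocks change places.
\<close>

lemma swap_segments:
  assumes "finite V" "E \<subseteq> V \<times> V" and f: "dot_numbering k x f E"
    and pq: "dot k p p = 0" "dot k q q = 0" "dot k p q = 1"
    and p: "\<And>v. v \<in> V \<Longrightarrow> dot k (x v) p = 1 \<longleftrightarrow> f v < c"
    and q: "\<And>v. v \<in> V \<Longrightarrow> dot k (x v) q = 1 \<longleftrightarrow> f v < d"
    and "c \<le> d"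
  shows "\<exists>y g. dot_numbering k y g E \<and>
    (\<forall>v. dot k (y v) p = 0 \<and> dot k (y v) q = 0)"
proof -
  obtain N where N: "\<And>v. v \<in> V \<Longrightarrow> \<bar>f v\<bar> < N" using finite_int_bound[OF assms(1)] by blast
  define y where "y v = (\<lambda>i. (x v i + dot k (x v) p * q i) + dot k (x v) q * p i)" for v
  \<comment> \<open>Shifts by multiples of \<open>2 * N\<close> give disjoint ranges, in the order: segment of \<open>q\<close> only, segment of
    \<open>p\<close>, the rest.\<close>
  define g where "g v = (if f v < c then f v + 2 * N else if f v < d then f v else f v + 4 * N)" for v
  have qp: "dot k q p = 1" using pq(3) by (simp add: dot_commute)
  have dot_pq: "dot k (y v) p = 0 \<and> dot k (y v) q = 0" for v
    unfolding y_def dot_add_scaled_left pq qp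
    by (cases "dot k (x v) p"; cases "dot k (x v) q") simp_all
  have dot_y: "dot k (y u) (y v) = dot k (x u) (x v)
      + (dot k (x u) p * dot k (x v) q + dot k (x u) q * dot k (x v) p)" for u v
    unfolding y_def dot_add_scaled_left dot_add_scaled_right pq qp
      dot_commute[of k p "x v"] dot_commute[of k q "x v"]
    by (cases "dot k (x u) p"; cases "dot k (x v) p"; cases "dot k (x u) q"; cases "dot k (x v) q")
      simp_all
  have "if dot k (y u) (y v) = 1 then g v < g u else g u < g v" if "(u, v) \<in> E" for u v
  proof -
    have uv: "u \<in> V" "v \<in> V" using that assms(2) by auto
    show ?thesis
      using dot_numberingD[OF f that] p[OF uv(1)] p[OF uv(2)] q[OF uv(1)] q[OF uv(2)]
        N[OF uv(1)] N[OF uv(2)] \<open>c \<le> d\<close>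
      unfolding dot_y g_def
      by (cases "dot k (x u) (x v)"; cases "dot k (x u) p"; cases "dot k (x v) p";
          cases "dot k (x u) q"; cases "dot k (x v) q") (simp_all split: if_splits)
  qed
  then have "dot_numbering k y g E" by (rule dot_numberingI)
  then show ?thesis using dot_pq by blast
qed

text \<open>
  If \<open>p\<close> or \<open>q\<close> is anisotropic, that vector alone can serve as both \<open>p'\<close> and \<open>q'\<close>. Otherwise \<open>p\<close> and
  \<open>q\<close> are kept, and the two thresholds decide which one cuts out the smaller segment.
\<close>

lemma orthogonalise:
  assumes "finite V" "E \<subseteq> V \<times> V" "dot_numbering k x f E"
    and "dot k p q = 1"
    and "\<And>v. v \<in> V \<Longrightarrow> dot k (x v) p = 1 \<longleftrightarrow> f v < c"
    and "\<And>v. v \<in> V \<Longrightarrow> dot k (x v) q = 1 \<longleftrightarrow> f v < d"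
  shows "\<exists>y g p' q'. dot_numbering k y g E \<and> dot k p' q' = 1 \<and>
    (\<forall>v. dot k (y v) p' = 0 \<and> dot k (y v) q' = 0)"
proof -
  consider "dot k p p = 1" | "dot k q q = 1" | "dot k p p = 0" "dot k q q = 0"
    by (cases "dot k p p"; cases "dot k q q") simp_all
  then show ?thesis
  proof cases
    case 1
    from reverse_segment[OF assms(1-3) 1 assms(5)] 1 show ?thesis by blast
  next
    case 2
    from reverse_segment[OF assms(1-3) 2 assms(6)] 2 show ?thesis by blast
  next
    case 3
    have qp: "dot k q p = 1" using assms(4) by (simp add: dot_commute)
    show ?thesis
    proof (cases "c \<le> d")
      case True
      from swap_segments[OF assms(1-3) 3 assms(4-6) True] assms(4) show ?thesis by blast
    next
      case False
      then have "d \<le> c" by simp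
      from swap_segments[OF assms(1-3) 3(2,1) qp assms(6,5) this] qp show ?thesis by blast
    qed
  qed
qed

text \<open>
  Negating the numbering turns final segments into initial ones, at the price of reversing all arcs.
\<close>

lemma orthogonalise_final:
  assumes "finite V" "E \<subseteq> V \<times> V" "dot_numbering k x f E"
    and "dot k p q = 1"
    and "\<And>v. v \<in> V \<Longrightarrow> dot k (x v) p = 1 \<longleftrightarrow> c < f v"
    and "\<And>v. v \<in> V \<Longrightarrow> dot k (x v) q = 1 \<longleftrightarrow> d < f v"
  shows "\<exists>y g p' q'. dot_numbering k y g E \<and> dot k p' q' = 1 \<and>
    (\<forall>v. dot k (y v) p' = 0 \<and> dot k (y v) q' = 0)"
proof -
  have "\<exists>y g p' q'. dot_numbering k y g (E\<inverse>) \<and> dot k p' q' = 1 \<and>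
      (\<forall>v. dot k (y v) p' = 0 \<and> dot k (y v) q' = 0)"
    by (rule orthogonalise[where V = V and x = x and f = "\<lambda>v. - f v" and p = p and q = q
          and c = "- c" and d = "- d"]) (use assms in \<open>auto simp: dot_numbering_converse\<close>)
  then show ?thesis unfolding dot_numbering_converse by blast
qed

section \<open>Dijoins with the directed triangle\<close>

lemma dot_numbering_dijoin:
  "dot_numbering k z f (parcs (dijoin L R)) \<longleftrightarrow>
    dot_numbering k (\<lambda>v. z (Inl v)) (\<lambda>v. f (Inl v)) (parcs L) \<and>
    dot_numbering k (\<lambda>v. z (Inr v)) (\<lambda>v. f (Inr v)) (parcs R) \<and>
    (\<forall>u \<in> pverts L. \<forall>v \<in> pverts R. if dot k (z (Inl u)) (z (Inr v)) = 1
      then f (Inr v) < f (Inl u) else f (Inl u) < f (Inr v))"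
proof -
  have "(\<forall>u v. (u, v) \<in> parcs (dijoin L R) \<longrightarrow> P u v) \<longleftrightarrow>
      (\<forall>u v. (u, v) \<in> parcs L \<longrightarrow> P (Inl u) (Inl v)) \<and>
      (\<forall>u v. (u, v) \<in> parcs R \<longrightarrow> P (Inr u) (Inr v)) \<and>
      (\<forall>u \<in> pverts L. \<forall>v \<in> pverts R. P (Inl u) (Inr v))" for P
    by (auto simp: dijoin_def) (blast intro: map_prod_imageI)+
  then show ?thesis unfolding dot_numbering_iff .
qed

lemma directed_C3_reversed_arc:
  assumes "dot_numbering k z f (parcs directed_C3)"
  obtains i j where "i \<in> pverts directed_C3" "j \<in> pverts directed_C3" "dot k (z i) (z j) = 1"
proof -
  have C3: "(0, 1) \<in> parcs directed_C3" "(1, 2) \<in> parcs directed_C3" "(2, 0) \<in> parcs directed_C3"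
    by (simp_all add: directed_C3_def)
  have "dot k (z 0) (z 1) = 1 \<or> dot k (z 1) (z 2) = 1 \<or> dot k (z 2) (z 0) = 1"
    using C3[THEN dot_numberingD[OF assms]] by (auto split: if_splits)
  then show ?thesis using that by (auto simp: directed_C3_def)
qed

text \<open>
  This condition does not mention the triangle. It turns out to characterise when either dijoin of
  \<open>D\<close> with the triangle has a decycling family of size \<open>k\<close>, which makes the two equivalent.
\<close>

definition orthogonal_pair_decycling :: "nat \<Rightarrow> 'a pair_pre_digraph \<Rightarrow> bool" where
  "orthogonal_pair_decycling k D \<longleftrightarrow>
    (\<exists>y g p q. dot_numbering k y g (parcs D) \<and> dot k p q = 1 \<and>
      (\<forall>v. dot k (y v) p = 0 \<and> dot k (y v) q = 0))"

text \<open>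
  The triangle with vectors \<open>0\<close>, \<open>p\<close>, \<open>q\<close> at its vertices \<open>0\<close>, \<open>1\<close>, \<open>2\<close> has only the arc from \<open>1\<close> to \<open>2\<close> reversed, which leaves the
  transitive order \<open>2\<close>, \<open>0\<close>, \<open>1\<close>. By orthogonality no arc between the triangle and \<open>D\<close> is reversed, so the triangle
  can be numbered entirely before \<open>D\<close> in one dijoin and entirely after \<open>D\<close> in the other.
\<close>

lemma orthogonal_pair_decycling_imp:
  assumes "finite (pverts D)" "parcs D \<subseteq> pverts D \<times> pverts D" "orthogonal_pair_decycling k D"
  shows "\<exists>z f. dot_numbering k z f (parcs (dijoin directed_C3 D))"
    and "\<exists>z f. dot_numbering k z f (parcs (dijoin D directed_C3))"
proof -
  obtain y g p q where g: "dot_numbering k y g (parcs D)"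
    and pq: "dot k p q = 1" and y: "\<And>v. dot k (y v) p = 0" "\<And>v. dot k (y v) q = 0"
    using assms(3) by (auto simp: orthogonal_pair_decycling_def)
  obtain N where N: "\<And>v. v \<in> pverts D \<Longrightarrow> \<bar>g v\<bar> < N" using finite_int_bound[OF assms(1)] by blast
  define t where "t i = (if i = 0 then (\<lambda>_. 0) else if i = 1 then p else q)" for i :: nat
  define h where "h i = (if i = 0 then 1 else if i = 1 then 2 else (0 :: int))" for i :: nat
  have h: "dot_numbering k t (\<lambda>i. h i + s) (parcs directed_C3)" for s
    by (simp add: dot_numbering_iff directed_C3_def t_def h_def dot_zero pq)
  have t: "dot k (y v) (t i) = 0" "dot k (t i) (y v) = 0" for v i
    using y by (simp_all add: t_def dot_zero dot_commute[of k _ "y v"])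
  have h_bounds: "0 \<le> h i" "h i \<le> 2" for i by (simp_all add: h_def)
  have "dot_numbering k (case_sum t y)
      (case_sum (\<lambda>i. h i + (- N - 2)) g) (parcs (dijoin directed_C3 D))"
    using g h[of "- N - 2"] N h_bounds t by (simp add: dot_numbering_dijoin) (smt (verit, best))
  then show "\<exists>z f. dot_numbering k z f (parcs (dijoin directed_C3 D))"
    by (intro exI)
  have "dot_numbering k (case_sum y t)
      (case_sum g (\<lambda>i. h i + N)) (parcs (dijoin D directed_C3))"
    using g h[of N] N h_bounds t by (simp add: dot_numbering_dijoin) (smt (verit, best))
  then show "\<exists>z f. dot_numbering k z f (parcs (dijoin D directed_C3))"
    by (intro exI)
qed

text \<open>
  A vertex \<open>v\<close> of \<open>D\<close> precedes a triangle vertex in the numbering iff the arc between them, which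
  leaves the triangle, is reversed. So the vectors of the triangle cut out initial segments of \<open>D\<close>.
\<close>

lemma orthogonal_pair_decycling_if_C3_first:
  assumes "finite (pverts D)" "parcs D \<subseteq> pverts D \<times> pverts D"
    and "dot_numbering k z f (parcs (dijoin directed_C3 D))"
  shows "orthogonal_pair_decycling k D"
proof -
  have C: "dot_numbering k (\<lambda>v. z (Inl v)) (\<lambda>v. f (Inl v)) (parcs directed_C3)"
    and D: "dot_numbering k (\<lambda>v. z (Inr v)) (\<lambda>v. f (Inr v)) (parcs D)"
    and CD: "\<And>i v. i \<in> pverts directed_C3 \<Longrightarrow> v \<in> pverts D \<Longrightarrow>
      if dot k (z (Inl i)) (z (Inr v)) = 1 then f (Inr v) < f (Inl i) else f (Inl i) < f (Inr v)"
    using assms(3) by (simp_all add: dot_numbering_dijoin)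
  obtain i j where ij: "i \<in> pverts directed_C3" "j \<in> pverts directed_C3"
    and "dot k (z (Inl i)) (z (Inl j)) = 1"
    using directed_C3_reversed_arc[OF C] .
  note this(3)
  moreover have "dot k (z (Inr v)) (z (Inl l)) = 1 \<longleftrightarrow> f (Inr v) < f (Inl l)"
    if "l \<in> pverts directed_C3" "v \<in> pverts D" for l v
    using CD[OF that] by (auto simp: dot_commute split: if_splits)
  ultimately show ?thesis
    unfolding orthogonal_pair_decycling_def
    using orthogonalise[OF assms(1,2) D] ij by blast
qed

text \<open>
  Here the arcs enter the triangle, and its vectors cut out final segments.
\<close>

lemma orthogonal_pair_decycling_if_C3_last:
  assumes "finite (pverts D)" "parcs D \<subseteq> pverts D \<times> pverts D"
    and "dot_numbering k z f (parcs (dijoin D directed_C3))"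
  shows "orthogonal_pair_decycling k D"
proof -
  have C: "dot_numbering k (\<lambda>v. z (Inr v)) (\<lambda>v. f (Inr v)) (parcs directed_C3)"
    and D: "dot_numbering k (\<lambda>v. z (Inl v)) (\<lambda>v. f (Inl v)) (parcs D)"
    and DC: "\<And>i v. i \<in> pverts directed_C3 \<Longrightarrow> v \<in> pverts D \<Longrightarrow>
      if dot k (z (Inl v)) (z (Inr i)) = 1 then f (Inr i) < f (Inl v) else f (Inl v) < f (Inr i)"
    using assms(3) by (simp_all add: dot_numbering_dijoin)
  obtain i j where ij: "i \<in> pverts directed_C3" "j \<in> pverts directed_C3"
    and "dot k (z (Inr i)) (z (Inr j)) = 1"
    using directed_C3_reversed_arc[OF C] .
  note this(3)
  moreover have "dot k (z (Inl v)) (z (Inr l)) = 1 \<longleftrightarrow> f (Inr l) < f (Inl v)"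
    if "l \<in> pverts directed_C3" "v \<in> pverts D" for l v
    using DC[OF that] by (auto split: if_splits)
  ultimately show ?thesis
    unfolding orthogonal_pair_decycling_def
    using orthogonalise_final[OF assms(1,2) D] ij by blast
qed

theorem theorem1p8:
  fixes D :: "'a pair_pre_digraph"
  assumes "oriented_graph D"
  shows "inversion_number (dijoin directed_C3 D) = inversion_number (dijoin D directed_C3)"
proof -
  interpret oriented_graph D by fact
  have D: "finite (pverts D)" "parcs D \<subseteq> pverts D \<times> pverts D"
    by (auto dest: in_arcsD1 in_arcsD2)
  have "(\<exists>Xs. length Xs = k \<and> decycling_family (dijoin directed_C3 D) Xs) \<longleftrightarrow>
      (\<exists>Xs. length Xs = k \<and> decycling_family (dijoin D directed_C3) Xs)" for k
    unfolding decycling_family_iff[OF oriented_graph_dijoin[OF oriented_graph_directed_C3 assms]]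
      decycling_family_iff[OF oriented_graph_dijoin[OF assms oriented_graph_directed_C3]]
    using orthogonal_pair_decycling_imp[OF D] orthogonal_pair_decycling_if_C3_first[OF D]
      orthogonal_pair_decycling_if_C3_last[OF D]
    by blast
  then show ?thesis by (simp add: inversion_number_def)
qed

end
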